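(* Let $0 \leq k<1$ and $k'=\sqrt[3]{1-k^3}$. Then $$K_3(k)=\frac{\pi_3}{2}\,\frac{1}{M_3(1,k')}.$$
   Context: $\pi_3:=2\int_0^1\frac{dt}{(1-t^3)^{1/3}}=\frac{2\pi}{3\sin(\pi/3)}=\frac{4\sqrt3\,\pi}{9}$. For $k\in[0,1)$, $$K_3(k):=\int_0^1 \frac{dt}{(1-t^3)^{1/3}(1-k^3t^3)^{2/3}}.$$ For $a\ge b>0$, define sequences by $a_0=a$, $b_0=b$ and $$a_{n+1}=\frac{a_n+2b_n}{3},\qquad b_{n+1}=\sqrt[3]{\frac{(a_n^2+a_nb_n+b_n^2)b_n}{3}},\qquad n=0,1,2,\ldots.$$ Both sequences converge to the same limit as $n\to\infty$, which is denoted by $M_3(a,b)$. *)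

theory Defs
  imports "HOL-Analysis.Analysis"
begin

text \<open>
  The integrals are Henstock-Kurzweil integrals, so the singularity of the integrand at
  \<open>t = 1\<close> needs no special treatment; its value there is \<open>1 / 0 = 0\<close> and is irrelevant.
  On \<open>{0..1}\<close> all bases of \<open>powr\<close> are nonnegative.
\<close>

definition pi3 :: real where
  "pi3 = 2 * integral {0..1} (\<lambda>t::real. 1 / (1 - t^3) powr (1/3))"

definition K3 :: "real \<Rightarrow> real" where
  "K3 k = integral {0..1} (\<lambda>t::real. 1 / ((1 - t^3) powr (1/3) * (1 - k^3 * t^3) powr (2/3)))"

fun a_seq b_seq :: "real \<Rightarrow> real \<Rightarrow> nat \<Rightarrow> real" where
  "a_seq a b 0 = a"
| "b_seq a b 0 = b"
| "a_seq a b (Suc n) = (a_seq a b n + 2 * b_seq a b n) / 3"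
| "b_seq a b (Suc n) =
     root 3 (((a_seq a b n)^2 + a_seq a b n * b_seq a b n + (b_seq a b n)^2) * b_seq a b n / 3)"

text \<open>Meaningful for \<open>a \<ge> b > 0\<close>, where \<open>a_seq\<close> and \<open>b_seq\<close> have a common limit
  (\<open>a_seq_tendsto_M3\<close> and \<open>b_seq_tendsto_M3\<close> below).\<close>

definition M3 :: "real \<Rightarrow> real \<Rightarrow> real" where
  "M3 a b = lim (a_seq a b)"

lemma step_bounds:
  fixes x y :: real
  assumes "0 < y" "y \<le> x"
  shows "y \<le> root 3 ((x^2 + x*y + y^2) * y / 3)"
    and "root 3 ((x^2 + x*y + y^2) * y / 3) \<le> (x + 2*y) / 3"
proof -
  have "y^2 \<le> x^2" "y * y \<le> x * y"
    using assms by (auto intro: power_mono mult_right_mono)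
  then have "3 * y^2 \<le> x^2 + x*y + y^2" by (simp add: power2_eq_square)
  then have "3 * y^2 * y \<le> (x^2 + x*y + y^2) * y"
    using assms(1) by (intro mult_right_mono) auto
  then have "y^3 \<le> (x^2 + x*y + y^2) * y / 3"
    by (simp add: power2_eq_square power3_eq_cube)
  then have "root 3 (y^3) \<le> root 3 ((x^2 + x*y + y^2) * y / 3)" by simp
  then show "y \<le> root 3 ((x^2 + x*y + y^2) * y / 3)"
    using assms by (simp add: real_root_power_cancel)
  have "((x + 2*y) / 3)^3 - (x^2 + x*y + y^2) * y / 3 = (x - y)^3 / 27"
    by (simp add: field_simps power2_eq_square power3_eq_cube)
  moreover have "0 \<le> (x - y)^3 / 27" using assms by simp
  ultimately have "(x^2 + x*y + y^2) * y / 3 \<le> ((x + 2*y) / 3)^3" by linarith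
  then have "root 3 ((x^2 + x*y + y^2) * y / 3) \<le> root 3 (((x + 2*y) / 3)^3)" by simp
  then show "root 3 ((x^2 + x*y + y^2) * y / 3) \<le> (x + 2*y) / 3"
    using assms by (subst (asm) real_root_power_cancel) auto
qed

lemma b_seq_pos_le_a_seq:
  assumes "0 < b" "b \<le> a"
  shows "0 < b_seq a b n \<and> b_seq a b n \<le> a_seq a b n"
proof (induction n)
  case 0
  then show ?case using assms by simp
next
  case (Suc n)
  then have p: "0 < b_seq a b n" "b_seq a b n \<le> a_seq a b n" by auto
  show ?case
    using less_le_trans[OF p(1) step_bounds(1)[OF p]]
      step_bounds(2)[OF p]
    by (simp only: a_seq.simps b_seq.simps)
qed

lemma seq_diff_le:
  assumes "0 < b" "b \<le> a"
  shows "a_seq a b n - b_seq a b n \<le> (a - b) * (1/3)^n"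
proof (induction n)
  case (Suc n)
  have step: "(x + 2 * y) / 3 - r \<le> (x - y) / 3" if "y \<le> r" for x y r :: real
    using that by (simp add: add_divide_distrib diff_divide_distrib)
  have "b_seq a b n \<le> b_seq a b (Suc n)"
    using step_bounds(1)[of "b_seq a b n" "a_seq a b n"] b_seq_pos_le_a_seq[OF assms, of n]
    by (simp only: b_seq.simps)
  then have "a_seq a b (Suc n) - b_seq a b (Suc n) \<le> (a_seq a b n - b_seq a b n) / 3"
    unfolding a_seq.simps by (rule step)
  also have "\<dots> \<le> (a - b) * (1/3)^n / 3" using Suc.IH by (rule divide_right_mono) simp
  finally show ?case by (simp only: power_Suc mult_ac times_divide_eq_right mult_1_right)
qed simp

lemma a_seq_tendsto_M3:
  assumes "0 < b" "b \<le> a"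
  shows "a_seq a b \<longlonglongrightarrow> M3 a b"
proof -
  note p = b_seq_pos_le_a_seq[OF assms]
  have "decseq (a_seq a b)"
    by (rule decseq_SucI) (use p in \<open>simp add: field_simps\<close>)
  moreover have "\<And>i. 0 \<le> a_seq a b i" using p by (meson less_imp_le order_trans)
  ultimately obtain L where "a_seq a b \<longlonglongrightarrow> L" using decseq_convergent by blast
  then show ?thesis unfolding M3_def by (simp add: limI)
qed

lemma b_seq_tendsto_M3:
  assumes "0 < b" "b \<le> a"
  shows "b_seq a b \<longlonglongrightarrow> M3 a b"
proof -
  have "(\<lambda>n. (a - b) * (1/3)^n) \<longlonglongrightarrow> (a - b) * 0"
    by (intro tendsto_mult tendsto_const LIMSEQ_realpow_zero) auto
  then have z: "(\<lambda>n. (a - b) * (1/3)^n) \<longlonglongrightarrow> 0" by simp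
  have d: "(\<lambda>n. a_seq a b n - b_seq a b n) \<longlonglongrightarrow> 0"
  proof (rule tendsto_sandwich[OF _ _ tendsto_const z]; rule always_eventually; rule allI)
    show "0 \<le> a_seq a b n - b_seq a b n" for n
      using b_seq_pos_le_a_seq[OF assms, of n] by linarith
    show "a_seq a b n - b_seq a b n \<le> (a - b) * (1/3)^n" for n
      by (rule seq_diff_le[OF assms])
  qed
  from tendsto_diff[OF a_seq_tendsto_M3[OF assms] d] show ?thesis by simp
qed

text \<open>The defining integrals exist; \<open>pi3\<close> is the case \<open>k = 0\<close>.\<close>

lemma K3_integrable:
  fixes k :: real
  assumes "0 \<le> k" "k < 1"
  shows "(\<lambda>t::real. 1 / ((1 - t^3) powr (1/3) * (1 - k^3 * t^3) powr (2/3))) integrable_on {0..1}"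
proof -
  define c where "c = (1 - k^3) powr (-2/3)"
  have k3: "k^3 < 1" using assms by (simp add: power_less_one_iff)
  have "(\<lambda>x::real. x powr (-1/3)) integrable_on {0..1}"
    using integrable_on_powr_from_0[of "-1/3" 1] by simp
  then have "(\<lambda>x::real. x powr (-1/3)) integrable_on cbox 0 1" by simp
  from integrable_affinity[OF this, of "-1" 1]
  have i: "(\<lambda>t::real. (1 - t) powr (-1/3)) integrable_on {0..1}" by simp
  have "(\<lambda>t::real. 1 / ((1 - t^3) powr (1/3) * (1 - k^3 * t^3) powr (2/3)))
      absolutely_integrable_on {0..1}"
  proof (rule measurable_bounded_by_integrable_imp_absolutely_integrable)
    show "(\<lambda>t::real. c * (1 - t) powr (-1/3)) integrable_on {0..1}"
      using integrable_on_cmult_left[OF i] by simp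
    have "(\<lambda>t::real. 1 / ((1 - t^3) powr (1/3) * (1 - k^3 * t^3) powr (2/3))) \<in> borel_measurable borel"
      by measurable
    then show "(\<lambda>t::real. 1 / ((1 - t^3) powr (1/3) * (1 - k^3 * t^3) powr (2/3)))
        \<in> borel_measurable (lebesgue_on {0..1})"
      by (intro measurable_restrict_space1 measurable_completion) simp
  next
    fix t :: real
    assume t: "t \<in> {0..1}"
    show "norm (1 / ((1 - t^3) powr (1/3) * (1 - k^3 * t^3) powr (2/3))) \<le> c * (1 - t) powr (-1/3)"
    proof (cases "t = 1")
      case True
      then show ?thesis by simp
    next
      case False
      have t1: "t^3 \<le> t" using t power_decreasing[of 1 3 t] by simp
      have t3: "k^3 * t^3 \<le> k^3 * 1"
        using t assms by (intro mult_left_mono) (auto simp: power_le_one)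
      have "(1 - t^3) powr (-1/3) \<le> (1 - t) powr (-1/3)"
        using t t1 False by (intro powr_mono2') auto
      moreover have "(1 - k^3 * t^3) powr (-2/3) \<le> c"
        unfolding c_def using t3 k3 by (intro powr_mono2') auto
      ultimately have "(1 - k^3 * t^3) powr (-2/3) * (1 - t^3) powr (-1/3) \<le> c * (1 - t) powr (-1/3)"
        by (intro mult_mono) (auto simp: c_def)
      moreover have "1 / ((1 - t^3) powr (1/3) * (1 - k^3 * t^3) powr (2/3)) =
          (1 - k^3 * t^3) powr (-2/3) * (1 - t^3) powr (-1/3)"
        using powr_minus_divide[of "1 - t^3" "1/3"] powr_minus_divide[of "1 - k^3 * t^3" "2/3"] by simp
      ultimately show ?thesis by simp
    qed
  qed simp
  then show ?thesis by (rule absolutely_integrable_on_def[THEN iffD1, THEN conjunct1])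
qed

lemma pi3_integrable: "(\<lambda>t::real. 1 / (1 - t^3) powr (1/3)) integrable_on {0..1}"
  using K3_integrable[of 0] by simp

end

theory Submission
  imports Defs
begin

text \<open>
  Expanding \<open>(1 - k^3 t^3) powr (-2/3)\<close> and integrating termwise gives
  \<open>K3 k = pi3 / 2 * F (k^3)\<close> with \<open>F = 2F1(1/3, 2/3; 1; -)\<close>. The functions \<open>F (1 - x^3)\<close> and
  \<open>3 / (1 + 2 x) * F (((1 - x) / (1 + 2 x))^3)\<close> solve the same second-order equation with a
  regular singular point at \<open>x = 1\<close>, where both are regular with value \<open>1\<close>, so they coincide. For
  \<open>x = b / a\<close> this says that \<open>F (1 - (b/a)^3) / a\<close> is invariant under the mean iteration, and
  its limit along the iteration is \<open>1 / M3 a b\<close>.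
\<close>

section \<open>The hypergeometric series and its differential equation\<close>

definition hyp_coeff :: "nat \<Rightarrow> real" where
  "hyp_coeff n = pochhammer (1/3) n * pochhammer (2/3) n / (fact n)^2"

definition hyp :: "real \<Rightarrow> real" where
  "hyp z = (\<Sum>n. hyp_coeff n * z^n)"

definition hyp' :: "real \<Rightarrow> real" where
  "hyp' z = (\<Sum>n. diffs hyp_coeff n * z^n)"

lemma hyp_coeff_0 [simp]: "hyp_coeff 0 = 1"
  by (simp add: hyp_coeff_def)

text \<open>Consecutive coefficients have ratio \<open>(n + 1/3) * (n + 2/3) / (n + 1)^2\<close>;
  cleared of denominators, this recurrence is the source of the differential equation.\<close>

lemma hyp_coeff_Suc:
  "(real n + 1)^2 * hyp_coeff (Suc n) = (real n ^ 2 + real n + 2/9) * hyp_coeff n"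
proof -
  define P where "P = pochhammer (1/3 :: real) n * pochhammer (2/3) n"
  define f where "f = (fact n :: real)"
  have f: "f \<noteq> 0" by (simp add: f_def)
  have n: "real n + 1 \<noteq> 0" by linarith
  have "hyp_coeff (Suc n) = P * ((1/3 + real n) * (2/3 + real n)) / ((real n + 1) * f)^2"
    by (simp add: hyp_coeff_def P_def f_def pochhammer_Suc mult_ac add_ac)
  moreover have "hyp_coeff n = P / f^2" by (simp add: hyp_coeff_def P_def f_def)
  ultimately show ?thesis using f n
    by (simp add: power_mult_distrib) (simp add: field_simps power2_eq_square)
qed

lemma hyp_coeff_nonneg: "0 \<le> hyp_coeff n"
  by (simp add: hyp_coeff_def pochhammer_nonneg)

lemma hyp_coeff_le_1: "hyp_coeff n \<le> 1"
proof (induction n)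
  case (Suc n)
  have "(real n + 1)^2 * hyp_coeff (Suc n) \<le> (real n + 1)^2 * hyp_coeff n"
    unfolding hyp_coeff_Suc
    by (intro mult_right_mono hyp_coeff_nonneg) (simp add: power2_eq_square algebra_simps)
  then have "hyp_coeff (Suc n) \<le> hyp_coeff n"
    by (rule mult_left_le_imp_le) (simp add: add_nonneg_pos)
  with Suc show ?case by simp
qed simp

text \<open>Comparison with the geometric series. The crude bound by 1 is enough for both
  \<open>hyp_coeff\<close> and the auxiliary series in \<open>hyp_ode\<close>.\<close>

lemma summable_bounded_coeff:
  fixes c :: "nat \<Rightarrow> real"
  assumes "\<And>n. \<bar>c n\<bar> \<le> 1" "\<bar>z\<bar> < 1"
  shows "summable (\<lambda>n. c n * z^n)"
proof (rule summable_comparison_test')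
  show "summable (\<lambda>n. \<bar>z\<bar>^n)" using assms by (intro summable_geometric) simp
  show "norm (c n * z^n) \<le> \<bar>z\<bar>^n" for n
    using assms(1)[of n] by (simp add: abs_mult power_abs mult_left_le_one_le)
qed

lemma DERIV_bounded_coeff:
  fixes c :: "nat \<Rightarrow> real"
  assumes "\<And>n. \<bar>c n\<bar> \<le> 1" "\<bar>z\<bar> < 1"
  shows "((\<lambda>z. \<Sum>n. c n * z^n) has_real_derivative (\<Sum>n. diffs c n * z^n)) (at z)"
proof (rule termdiffs_strong)
  \<comment> \<open>Termwise differentiation needs convergence at a point beyond
    \<open>\<bar>z\<bar>\<close>; the midpoint of \<open>\<bar>z\<bar>\<close> and 1 serves.\<close>
  show "summable (\<lambda>n. c n * ((1 + \<bar>z\<bar>) / 2)^n)"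
    using assms by (intro summable_bounded_coeff) auto
  show "norm z < norm ((1 + \<bar>z\<bar>) / 2)" using assms by simp
qed

lemma summable_diffs_bounded_coeff:
  fixes c :: "nat \<Rightarrow> real"
  assumes "\<And>n. \<bar>c n\<bar> \<le> 1" "\<bar>z\<bar> < 1"
  shows "summable (\<lambda>n. diffs c n * z^n)"
proof (rule termdiff_converges)
  show "norm z < 1" using assms by simp
  show "summable (\<lambda>n. c n * x^n)" if "norm x < 1" for x
    using assms that by (intro summable_bounded_coeff) auto
qed

lemma abs_hyp_coeff_le_1: "\<bar>hyp_coeff n\<bar> \<le> 1"
  using hyp_coeff_nonneg[of n] hyp_coeff_le_1[of n] by simp

lemma hyp_0 [simp]: "hyp 0 = 1"
  using powser_zero[of hyp_coeff] by (simp add: hyp_def)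

text \<open>All terms are nonnegative and the first is 1. This gives the nonvanishing needed to
  divide by a solution in the uniqueness argument.\<close>

lemma hyp_ge_1:
  assumes "0 \<le> z" "z < 1"
  shows "1 \<le> hyp z"
proof -
  have "(\<Sum>n\<in>{0}. hyp_coeff n * z^n) \<le> hyp z"
    unfolding hyp_def
    using assms by (intro sum_le_suminf summable_bounded_coeff abs_hyp_coeff_le_1)
      (auto simp: hyp_coeff_nonneg)
  then show ?thesis by simp
qed

lemma DERIV_hyp:
  assumes "\<bar>z\<bar> < 1"
  shows "(hyp has_real_derivative hyp' z) (at z)"
  unfolding hyp_def[abs_def] hyp'_def
  using DERIV_bounded_coeff[of hyp_coeff z] abs_hyp_coeff_le_1 assms by simp

text \<open>The hypergeometric equation in self-adjoint form. Coefficientwise,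
  \<open>z * (1 - z) * hyp' z\<close> is a termwise antiderivative of \<open>2/9 * hyp z\<close>.\<close>

lemma hyp_ode:
  assumes "\<bar>z\<bar> < 1"
  shows "((\<lambda>z. z * (1 - z) * hyp' z) has_real_derivative 2/9 * hyp z) (at z)"
proof -
  \<comment> \<open>Coefficients of the antiderivative of \<open>2/9 * hyp\<close> that vanishes at
    0; they are bounded by 1, so the termwise lemmas apply.\<close>
  define g where "g n = (case n of 0 \<Rightarrow> 0 | Suc m \<Rightarrow> 2/9 * hyp_coeff m / (real m + 1))" for n
  have g1: "\<bar>g n\<bar> \<le> 1" for n
  proof (cases n)
    case (Suc m)
    have "2/9 * hyp_coeff m / (real m + 1) \<le> 1 / 1"
      using hyp_coeff_le_1[of m] hyp_coeff_nonneg[of m] by (intro frac_le) auto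
    then show ?thesis using Suc hyp_coeff_nonneg[of m] by (simp add: g_def)
  qed (simp add: g_def)
  have dg: "diffs g n = 2/9 * hyp_coeff n" for n
    by (simp add: diffs_def g_def field_simps)
  have gs: "(\<Sum>n. g n * w^n) = w * (1 - w) * hyp' w" if w: "\<bar>w\<bar> < 1" for w
  proof -
    have s: "(\<lambda>n. diffs hyp_coeff n * w^n) sums hyp' w"
      unfolding hyp'_def
      by (intro summable_sums summable_diffs_bounded_coeff abs_hyp_coeff_le_1 w)
    have shift: "(\<lambda>n. real n * hyp_coeff n * w^n) sums (w * hyp' w)"
    proof -
      have "(\<lambda>n. real (Suc n) * hyp_coeff (Suc n) * w^(Suc n)) sums (w * hyp' w)"
        using sums_mult[OF s, of w] by (simp add: diffs_def mult_ac)
      then show ?thesis by (subst (asm) sums_Suc_iff) simp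
    qed
    \<comment> \<open>The recurrence with its factor written as \<open>n * (n + 1) + 2/9\<close>:
      multiplying \<open>hyp'\<close> by \<open>1 - z\<close> cancels the part
      \<open>n * (n + 1)\<close>.\<close>
    have co: "diffs hyp_coeff n - real n * hyp_coeff n = g (Suc n)" for n
    proof -
      have "(real n + 1) * ((real n + 1) * hyp_coeff (Suc n) - real n * hyp_coeff n)
          = 2/9 * hyp_coeff n"
        using hyp_coeff_Suc[of n] by (simp add: power2_eq_square algebra_simps)
      moreover have "real n + 1 \<noteq> 0" by linarith
      ultimately show ?thesis by (simp add: diffs_def g_def field_simps)
    qed
    have "(\<lambda>n. (diffs hyp_coeff n - real n * hyp_coeff n) * w^n) sums (hyp' w - w * hyp' w)"
      using sums_diff[OF s shift] by (simp add: left_diff_distrib)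
    from sums_mult[OF this[unfolded co], of w]
    have "(\<lambda>n. g (Suc n) * w^(Suc n)) sums (w * (hyp' w - w * hyp' w))"
      by (simp add: mult_ac)
    then have "(\<lambda>n. g n * w^n) sums (w * (hyp' w - w * hyp' w))"
      by (subst (asm) sums_Suc_iff) (simp add: g_def)
    then show ?thesis by (simp add: sums_iff algebra_simps)
  qed
  have "((\<lambda>z. \<Sum>n. g n * z^n) has_real_derivative 2/9 * hyp z) (at z)"
  proof -
    have "(\<Sum>n. 2/9 * hyp_coeff n * z^n) = 2/9 * hyp z"
      unfolding hyp_def mult.assoc
      by (intro suminf_mult summable_bounded_coeff abs_hyp_coeff_le_1 assms)
    with DERIV_bounded_coeff[of g z, OF g1 assms] show ?thesis by (simp only: dg)
  qed
  then show ?thesis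
  proof (rule DERIV_cong_ev[THEN iffD1, rotated -1])
    have "\<forall>\<^sub>F w in nhds z. w \<in> {-1<..<1}"
      using assms by (intro eventually_nhds_in_open) auto
    then show "\<forall>\<^sub>F w in nhds z. (\<Sum>n. g n * w^n) = w * (1 - w) * hyp' w"
      by eventually_elim (simp add: gs abs_less_iff)
  qed simp_all
qed

section \<open>The equation in the cubic variable: involution and uniqueness\<close>

text \<open>The hypergeometric equation rewritten in the variable \<open>x\<close> with \<open>z = x^3\<close>; it takes the
  same form for \<open>z = 1 - x^3\<close>.\<close>

definition cubic_solution :: "(real \<Rightarrow> real) \<Rightarrow> (real \<Rightarrow> real) \<Rightarrow> real set \<Rightarrow> bool" where
  "cubic_solution f f' S \<longleftrightarrow> (\<forall>x\<in>S. (f has_real_derivative f' x) (at x) \<and>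
     ((\<lambda>x. (x - x^4) * f' x) has_real_derivative 2 * x^2 * f x) (at x))"

text \<open>At \<open>z = x^3\<close>, \<open>3 * (z * (1 - z) * hyp' z)\<close> is
  \<open>x - x^4\<close> times the derivative of \<open>hyp (x^3)\<close>, so the chain rule carries
  \<open>hyp_ode\<close> over. The interval contains 0, the image of \<open>x = 1\<close> under the
  involution below.\<close>

lemma cubic_solution_hyp_cube:
  "cubic_solution (\<lambda>x. hyp (x^3)) (\<lambda>x. 3 * x^2 * hyp' (x^3)) {-1<..<1}"
  unfolding cubic_solution_def
proof (intro ballI conjI)
  fix x :: real
  assume "x \<in> {-1<..<1}"
  then have z: "\<bar>x^3\<bar> < 1" by (simp add: power_abs power_less_one_iff abs_less_iff)
  have d: "((\<lambda>x. x^3) has_real_derivative 3 * x^2) (at x)"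
    by (auto intro!: derivative_eq_intros simp: power2_eq_square)
  show "((\<lambda>x. hyp (x^3)) has_real_derivative 3 * x^2 * hyp' (x^3)) (at x)"
    using DERIV_chain2[OF DERIV_hyp[OF z] d] by (simp add: mult_ac)
  have "((\<lambda>x. 3 * (x^3 * (1 - x^3) * hyp' (x^3))) has_real_derivative
      3 * (2/9 * hyp (x^3) * (3 * x^2))) (at x)"
    by (intro DERIV_cmult DERIV_chain2[OF hyp_ode[OF z] d])
  moreover have "3 * (y^3 * (1 - y^3) * c) = (y - y^4) * (3 * y^2 * c)" for y c :: real
    by (simp add: algebra_simps power2_eq_square power3_eq_cube power4_eq_xxxx)
  moreover have "3 * (2/9 * c * (3 * x^2)) = 2 * x^2 * c" for c
    by simp
  ultimately show "((\<lambda>x. (x - x^4) * (3 * x^2 * hyp' (x^3))) has_real_derivative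
      2 * x^2 * hyp (x^3)) (at x)"
    by (simp only:)
qed

text \<open>\<open>z * (1 - z)\<close> is symmetric in \<open>z\<close> and \<open>1 - z\<close>,
  and the sign from the chain rule occurs twice. The singular point \<open>x = 1\<close> is
  included: there \<open>z = 0\<close>, where the series is regular.\<close>

lemma cubic_solution_hyp_complement:
  "cubic_solution (\<lambda>x. hyp (1 - x^3)) (\<lambda>x. - 3 * x^2 * hyp' (1 - x^3)) {0<..1}"
  unfolding cubic_solution_def
proof (intro ballI conjI)
  fix x :: real
  assume x: "x \<in> {0<..1}"
  then have "0 < x^3" "x^3 \<le> 1" by (auto simp: power_le_one)
  then have z: "\<bar>1 - x^3\<bar> < 1" by simp
  have d: "((\<lambda>x. 1 - x^3) has_real_derivative - 3 * x^2) (at x)"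
    by (auto intro!: derivative_eq_intros simp: power2_eq_square)
  show "((\<lambda>x. hyp (1 - x^3)) has_real_derivative - 3 * x^2 * hyp' (1 - x^3)) (at x)"
    using DERIV_chain2[OF DERIV_hyp[OF z] d] by (simp add: mult_ac)
  have "((\<lambda>x. (-3) * ((1 - x^3) * (1 - (1 - x^3)) * hyp' (1 - x^3))) has_real_derivative
      (-3) * (2/9 * hyp (1 - x^3) * (- 3 * x^2))) (at x)"
    by (intro DERIV_cmult DERIV_chain2[OF hyp_ode[OF z] d])
  moreover have "(-3) * ((1 - y^3) * (1 - (1 - y^3)) * c) = (y - y^4) * (- 3 * y^2 * c)" for y c :: real
    by (simp add: algebra_simps power2_eq_square power3_eq_cube power4_eq_xxxx)
  moreover have "(-3) * (2/9 * c * (- 3 * x^2)) = 2 * x^2 * c" for c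
    by simp
  ultimately show "((\<lambda>x. (x - x^4) * (- 3 * x^2 * hyp' (1 - x^3))) has_real_derivative
      2 * x^2 * hyp (1 - x^3)) (at x)"
    by (simp only:)
qed

text \<open>The cubic equation is invariant under the involution \<open>x \<mapsto> (1 - x) / (1 + 2 * x)\<close>
  with multiplier \<open>3 / (1 + 2 * x)\<close>.\<close>

lemma cubic_solution_involution:
  assumes "cubic_solution f f' {-1<..<1}"
  shows "cubic_solution (\<lambda>x. 3 / (1 + 2*x) * f ((1 - x) / (1 + 2*x)))
    (\<lambda>x. - 6 / (1 + 2*x)^2 * f ((1 - x) / (1 + 2*x)) - 9 / (1 + 2*x)^3 * f' ((1 - x) / (1 + 2*x)))
    {0<..1}"
  unfolding cubic_solution_def
proof (intro ballI conjI)
  fix x :: real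
  assume x: "x \<in> {0<..1}"
  define u where "u x = (1 - x) / (1 + 2*x)" for x :: real
  have s: "1 + 2*x > 0" using x by simp
  have ux: "u x \<in> {-1<..<1}" using x s by (simp add: u_def field_simps)
  have du: "(u has_real_derivative - 3 / (1 + 2*x)^2) (at x)"
    unfolding u_def[abs_def] using s
    by (auto intro!: derivative_eq_intros simp: power2_eq_square field_simps)
  have df: "((\<lambda>x. f (u x)) has_real_derivative f' (u x) * (- 3 / (1 + 2*x)^2)) (at x)"
    using assms ux by (intro DERIV_chain2[OF _ du]) (auto simp: cubic_solution_def)
  define P where "P u = (u - u^4) * f' u" for u
  have dP: "((\<lambda>x. P (u x)) has_real_derivative 2 * u x ^ 2 * f (u x) * (- 3 / (1 + 2*x)^2)) (at x)"
    using assms ux unfolding P_def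
    by (intro DERIV_chain2[where f = "\<lambda>u. (u - u^4) * f' u", OF _ du])
      (auto simp: cubic_solution_def)
  \<comment> \<open>The weight \<open>x - x^4\<close> is reproduced by the involution up to a
    factor, because \<open>(1 + 2*y)^3 - (1 - y)^3 = 9 * y * (1 + y + y^2)\<close>.\<close>
  have uu: "u y - u y ^ 4 = 9 * (y - y^4) / (1 + 2*y)^4" if "1 + 2*y > 0" for y
  proof -
    have "u y - u y ^ 4 = ((1 - y) * (1 + 2*y)^3 - (1 - y)^4) / (1 + 2*y)^4"
      using that by (simp add: u_def power_divide diff_divide_distrib[of "_ * _"])
        (simp add: power3_eq_cube power4_eq_xxxx)
    also have "(1 - y) * (1 + 2*y)^3 - (1 - y)^4 = 9 * (y - y^4)"
      by (simp add: power3_eq_cube power4_eq_xxxx algebra_simps)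
    finally show ?thesis .
  qed
  have d3: "((\<lambda>x. 3 / (1 + 2*x)) has_real_derivative - 6 / (1 + 2*x)^2) (at x)"
    using s by (auto intro!: derivative_eq_intros simp: power2_eq_square)
  have "((\<lambda>x. 3 / (1 + 2*x) * f (u x)) has_real_derivative
      - 6 / (1 + 2*x)^2 * f (u x) - 9 / (1 + 2*x)^3 * f' (u x)) (at x)"
    by (rule DERIV_cong[OF DERIV_mult[OF d3 df]])
      (simp add: power2_eq_square power3_eq_cube)
  then show "((\<lambda>x. 3 / (1 + 2*x) * f ((1 - x) / (1 + 2*x))) has_real_derivative
      - 6 / (1 + 2*x)^2 * f ((1 - x) / (1 + 2*x)) - 9 / (1 + 2*x)^3 * f' ((1 - x) / (1 + 2*x))) (at x)"
    by (simp add: u_def)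
  \<comment> \<open>The equation gives a derivative for \<open>P\<close> but not for
    \<open>f'\<close> alone. So the weighted derivative of the new function is written as
    \<open>-6 * q x * f (u x) - (1 + 2*x) * P (u x)\<close> and differentiated in that form.\<close>
  define q where "q x = (x - x^4) / (1 + 2*x)^2" for x :: real
  have dq: "(q has_real_derivative (1 - 2*x - 4*x^3 - 4*x^4) / (1 + 2*x)^3) (at x)"
  proof -
    have "(q has_real_derivative ((1 - 4*x^3) * (1 + 2*x)^2 - (x - x^4) * (2 * (1 + 2*x) * 2))
        / ((1 + 2*x)^2 * (1 + 2*x)^2)) (at x)"
      unfolding q_def[abs_def] using s
      by (auto intro!: derivative_eq_intros simp: power2_eq_square)
    also have "((1 - 4*x^3) * (1 + 2*x)^2 - (x - x^4) * (2 * (1 + 2*x) * 2))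
        = (1 + 2*x) * (1 - 2*x - 4*x^3 - 4*x^4)"
      by (simp add: power2_eq_square power3_eq_cube power4_eq_xxxx algebra_simps)
    also have "(1 + 2*x) * (1 - 2*x - 4*x^3 - 4*x^4) / ((1 + 2*x)^2 * (1 + 2*x)^2)
        = (1 - 2*x - 4*x^3 - 4*x^4) / (1 + 2*x)^3"
      using s by (simp add: power2_eq_square power3_eq_cube)
    finally show ?thesis .
  qed
  have dl: "((\<lambda>x. 1 + 2*x) has_real_derivative 2) (at x)"
    by (auto intro!: derivative_eq_intros)
  have "((\<lambda>x. (-6) * (q x * f (u x)) - (1 + 2*x) * P (u x)) has_real_derivative
      (-6) * ((1 - 2*x - 4*x^3 - 4*x^4) / (1 + 2*x)^3 * f (u x)
        + f' (u x) * (- 3 / (1 + 2*x)^2) * q x)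
      - (2 * P (u x) + 2 * u x ^ 2 * f (u x) * (- 3 / (1 + 2*x)^2) * (1 + 2*x))) (at x)"
    by (intro DERIV_diff DERIV_cmult DERIV_mult dq df dl dP)
  moreover have "(-6) * ((1 - 2*x - 4*x^3 - 4*x^4) / (1 + 2*x)^3 * f (u x)
        + f' (u x) * (- 3 / (1 + 2*x)^2) * q x)
      - (2 * P (u x) + 2 * u x ^ 2 * f (u x) * (- 3 / (1 + 2*x)^2) * (1 + 2*x))
      = 2 * x^2 * (3 / (1 + 2*x) * f (u x))"
  proof -
    \<comment> \<open>Puts \<open>2 * P (u x)\<close> in a form that cancels the
      \<open>f' (u x)\<close> term arising from \<open>q x * f (u x)\<close>; only a multiple of
      \<open>f (u x)\<close> remains, computed next.\<close>
    have p: "2 * P (u x) = 18 * q x / (1 + 2*x)^2 * f' (u x)"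
    proof -
      have "(1 + 2*x)^4 = (1 + 2*x)^2 * (1 + 2*x)^2" by (simp flip: power_add)
      then show ?thesis unfolding P_def uu[OF s] q_def by (simp only: divide_divide_eq_left) simp
    qed
    have "- 6 * ((1 - 2*x - 4*x^3 - 4*x^4) / (1 + 2*x)^3) + 6 * u x ^ 2 / (1 + 2*x)
        = 6 * ((1 - x)^2 - (1 - 2*x - 4*x^3 - 4*x^4)) / (1 + 2*x)^3"
    proof -
      have "6 * u x ^ 2 / (1 + 2*x) = 6 * (1 - x)^2 / (1 + 2*x)^3"
        by (simp add: u_def power_divide) (simp add: power2_eq_square power3_eq_cube)
      then show ?thesis
        by (simp only: times_divide_eq_right right_diff_distrib diff_divide_distrib)
    qed
    also have "(1 - x)^2 - (1 - 2*x - 4*x^3 - 4*x^4) = x^2 * (1 + 2*x)^2"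
      by (simp add: power2_eq_square power3_eq_cube power4_eq_xxxx algebra_simps)
    also have "6 * (x^2 * (1 + 2*x)^2) / (1 + 2*x)^3 = 6 * x^2 / (1 + 2*x)"
      using s by (simp add: power2_eq_square power3_eq_cube)
    finally have e: "- 6 * ((1 - 2*x - 4*x^3 - 4*x^4) / (1 + 2*x)^3) + 6 * u x ^ 2 / (1 + 2*x)
      = 6 * x^2 / (1 + 2*x)" .
    have r: "2 * u x ^ 2 * f (u x) * (- 3 / (1 + 2*x)^2) * (1 + 2*x)
        = - (6 * u x ^ 2 / (1 + 2*x)) * f (u x)"
      using s by (simp add: power2_eq_square)
    have "(-6) * ((1 - 2*x - 4*x^3 - 4*x^4) / (1 + 2*x)^3 * f (u x)
          + f' (u x) * (- 3 / (1 + 2*x)^2) * q x)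
        - (2 * P (u x) + 2 * u x ^ 2 * f (u x) * (- 3 / (1 + 2*x)^2) * (1 + 2*x))
      = (- 6 * ((1 - 2*x - 4*x^3 - 4*x^4) / (1 + 2*x)^3) + 6 * u x ^ 2 / (1 + 2*x)) * f (u x)"
      unfolding p r by (simp add: algebra_simps)
    then show ?thesis unfolding e by simp
  qed
  ultimately have D: "((\<lambda>x. (-6) * (q x * f (u x)) - (1 + 2*x) * P (u x)) has_real_derivative
      2 * x^2 * (3 / (1 + 2*x) * f (u x))) (at x)" by simp
  have "((\<lambda>x. (x - x^4) * (- 6 / (1 + 2*x)^2 * f (u x) - 9 / (1 + 2*x)^3 * f' (u x)))
      has_real_derivative 2 * x^2 * (3 / (1 + 2*x) * f (u x))) (at x)"
    using D
  proof (rule DERIV_cong_ev[THEN iffD1, rotated -1])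
    have "\<forall>\<^sub>F y in nhds x. y \<in> {0<..}"
      using x by (intro eventually_nhds_in_open) auto
    then show "\<forall>\<^sub>F y in nhds x. (-6) * (q y * f (u y)) - (1 + 2*y) * P (u y)
        = (y - y^4) * (- 6 / (1 + 2*y)^2 * f (u y) - 9 / (1 + 2*y)^3 * f' (u y))"
    proof eventually_elim
      case (elim y)
      then have y: "1 + 2*y > 0" by simp
      have "(1 + 2*y) * P (u y) = (y - y^4) * (9 / (1 + 2*y)^3 * f' (u y))"
      proof -
        have "(1 + 2*y)^4 = (1 + 2*y)^3 * (1 + 2*y)" by (simp add: numeral_eq_Suc)
        then show ?thesis unfolding P_def uu[OF y] using y by simp
      qed
      moreover have "(-6) * (q y * f (u y)) = (y - y^4) * (- 6 / (1 + 2*y)^2 * f (u y))"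
        by (simp add: q_def)
      ultimately show ?case by (simp add: right_diff_distrib)
    qed
  qed simp_all
  then show "((\<lambda>x. (x - x^4) * (- 6 / (1 + 2*x)^2 * f ((1 - x) / (1 + 2*x))
        - 9 / (1 + 2*x)^3 * f' ((1 - x) / (1 + 2*x))))
      has_real_derivative 2 * x^2 * (3 / (1 + 2*x) * f ((1 - x) / (1 + 2*x)))) (at x)"
    by (simp add: u_def)
qed

text \<open>The Wronskian times \<open>x - x^4\<close> is constant and vanishes at the singular point \<open>1\<close>; hence
  solutions that are differentiable at \<open>1\<close> are determined by their value there.\<close>

lemma cubic_solution_unique:
  assumes f: "cubic_solution f f' {0<..1}" and g: "cubic_solution g g' {0<..1}"
    and nz: "\<And>x. x \<in> {0<..1} \<Longrightarrow> f x \<noteq> 0" and eq: "f 1 = g 1"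
    and x: "x \<in> {0<..1}"
  shows "f x = g x"
proof -
  \<comment> \<open>The terms \<open>2 * y^2 * f y * g y\<close> and the products of derivatives
    cancel in pairs in the derivative of \<open>W\<close>.\<close>
  define W where "W x = f x * ((x - x^4) * g' x) - g x * ((x - x^4) * f' x)" for x
  have dW: "(W has_real_derivative 0) (at y within {0<..1})" if "y \<in> {0<..1}" for y
  proof -
    have "(W has_real_derivative (f' y * ((y - y^4) * g' y) + 2 * y^2 * g y * f y)
        - (g' y * ((y - y^4) * f' y) + 2 * y^2 * f y * g y)) (at y)"
      unfolding W_def[abs_def] using f g that
      by (intro DERIV_diff DERIV_mult) (auto simp: cubic_solution_def)
    then have "(W has_real_derivative 0) (at y)" by (simp add: algebra_simps)
    then show ?thesis by (rule has_field_derivative_at_within)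
  qed
  have W0: "W y = 0" if "y \<in> {0<..1}" for y
  proof -
    obtain c where "\<And>y. y \<in> {0<..1} \<Longrightarrow> W y = c"
      using has_field_derivative_zero_constant[of "{0<..1}" W] dW convex_real_interval by blast
    from this[of 1] this[OF that] show ?thesis by (simp add: W_def)
  qed
  \<comment> \<open>The numerator of the derivative of \<open>h\<close> is
    \<open>W y / (y - y^4)\<close>, hence zero for \<open>y < 1\<close>. At 1 the weight vanishes
    and \<open>W\<close> carries no information, so the value there is reached by continuity of
    \<open>h\<close>.\<close>
  define h where "h x = g x / f x" for x
  have dh: "(h has_real_derivative (g' y * f y - g y * f' y) / (f y * f y)) (at y)"
    if "y \<in> {0<..1}" for y
    unfolding h_def[abs_def] using f g that nz
    by (intro DERIV_divide) (auto simp: cubic_solution_def)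
  show ?thesis
  proof (cases "x = 1")
    case False
    then have x1: "x < 1" "0 < x" using x by auto
    have "h 1 = h x"
    proof (rule DERIV_isconst_end[OF x1(1)])
      show "continuous_on {x..1} h"
        using x1 by (intro DERIV_continuous_on[OF DERIV_subset[OF dh]]) auto
    next
      fix y assume y: "x < y" "y < 1"
      then have yI: "y \<in> {0<..1}" using x1 by simp
      have "y^3 < 1" using y x1 by (simp add: power_less_one_iff)
      then have "y * (1 - y^3) \<noteq> 0" using y x1 by simp
      then have "y - y^4 \<noteq> 0" by (simp add: power3_eq_cube power4_eq_xxxx algebra_simps)
      moreover have "(y - y^4) * (g' y * f y - g y * f' y) = 0"
        using W0[OF yI] by (simp add: W_def algebra_simps)
      ultimately show "(h has_real_derivative 0) (at y)" using dh[OF yI] by simp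
    qed
    then show ?thesis using nz[of 1] nz[OF x] eq by (simp add: h_def)
  qed (simp add: eq)
qed

section \<open>The cubic transformation and the mean iteration\<close>

lemma hyp_cubic_transformation:
  assumes "0 < x" "x \<le> 1"
  shows "hyp (1 - x^3) = 3 / (1 + 2*x) * hyp (((1 - x) / (1 + 2*x))^3)"
proof (rule cubic_solution_unique[OF cubic_solution_hyp_complement
      cubic_solution_involution[OF cubic_solution_hyp_cube]])
  fix y :: real assume "y \<in> {0<..1}"
  then have "1 \<le> hyp (1 - y^3)" by (intro hyp_ge_1) (auto simp: power_le_one)
  then show "hyp (1 - y^3) \<noteq> 0" by linarith
qed (use assms in auto)

text \<open>Take \<open>x = b/a\<close> in the cubic transformation. Since
  \<open>a'^3 - b'^3 = ((a - b) / 3)^3\<close>, the new argument is \<open>1 - (b'/a')^3\<close>,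
  and the multiplier \<open>3 / (1 + 2*x)\<close> is \<open>a / a'\<close>.\<close>

lemma hyp_agm_step:
  assumes "0 < b" "b \<le> a"
  defines "a' \<equiv> (a + 2*b) / 3" and "b' \<equiv> root 3 ((a^2 + a*b + b^2) * b / 3)"
  shows "hyp (1 - (b'/a')^3) / a' = hyp (1 - (b/a)^3) / a"
proof -
  have a: "0 < a" and s: "a + 2*b > 0" using assms by auto
  have b': "b'^3 = (a^2 + a*b + b^2) * b / 3"
    using assms a by (simp add: b'_def)
  have u: "(1 - b/a) / (1 + 2*(b/a)) = (a - b) / (a + 2*b)"
  proof -
    have "1 - b/a = (a - b) / a" "1 + 2*(b/a) = (a + 2*b) / a"
      using a by (simp_all add: diff_divide_distrib add_divide_distrib)
    then show ?thesis using a by simp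
  qed
  have "1 - (b'/a')^3 = ((a + 2*b)^3 - 27 * b'^3) / (a + 2*b)^3"
    using s by (simp add: a'_def power_divide power_mult_distrib diff_divide_distrib)
  also have "(a + 2*b)^3 - 27 * b'^3 = (a - b)^3"
    unfolding b' by (simp add: power2_eq_square power3_eq_cube algebra_simps)
  finally have e: "1 - (b'/a')^3 = ((1 - b/a) / (1 + 2*(b/a)))^3"
    unfolding u by (simp add: power_divide)
  have "hyp (1 - (b/a)^3) / a = 3 / (1 + 2*(b/a)) * hyp (1 - (b'/a')^3) / a"
    unfolding e using assms a by (subst hyp_cubic_transformation) auto
  also have "\<dots> = hyp (1 - (b'/a')^3) / a'"
  proof -
    have "1 + 2*(b/a) = (a + 2*b) / a" using a by (simp add: add_divide_distrib)
    then show ?thesis using a by (simp add: a'_def)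
  qed
  finally show ?thesis by simp
qed

text \<open>\<open>b_seq a b\<close> increases from \<open>b\<close>, so its limit is at least
  \<open>b\<close>.\<close>

lemma M3_pos:
  assumes "0 < b" "b \<le> a"
  shows "0 < M3 a b"
proof -
  have "b \<le> b_seq a b n" for n
  proof (induction n)
    case (Suc n)
    note p = b_seq_pos_le_a_seq[OF assms, of n]
    have "b_seq a b n \<le> b_seq a b (Suc n)"
      using step_bounds(1)[of "b_seq a b n" "a_seq a b n"] p by (simp only: b_seq.simps)
    with Suc show ?case by linarith
  qed simp
  then have "b \<le> M3 a b" using b_seq_tendsto_M3[OF assms] by (intro LIMSEQ_le_const) auto
  with assms show ?thesis by simp
qed

lemma hyp_eq_inverse_M3:
  assumes "0 < b" "b \<le> a"
  shows "hyp (1 - (b/a)^3) / a = 1 / M3 a b"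
proof -
  have inv: "hyp (1 - (b_seq a b n / a_seq a b n)^3) / a_seq a b n = hyp (1 - (b/a)^3) / a" for n
  proof (induction n)
    case (Suc n)
    then show ?case
      using hyp_agm_step[of "b_seq a b n" "a_seq a b n"] b_seq_pos_le_a_seq[OF assms, of n]
      by (simp only: a_seq.simps b_seq.simps)
  qed simp
  have M: "M3 a b \<noteq> 0" using M3_pos[OF assms] by simp
  note lims = a_seq_tendsto_M3[OF assms] b_seq_tendsto_M3[OF assms]
  have "(\<lambda>n. 1 - (b_seq a b n / a_seq a b n)^3) \<longlonglongrightarrow> 1 - (M3 a b / M3 a b)^3"
    using M by (intro tendsto_intros lims)
  then have z: "(\<lambda>n. 1 - (b_seq a b n / a_seq a b n)^3) \<longlonglongrightarrow> 0" using M by simp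
  \<comment> \<open>The ratio of the two sequences tends to 1, so the argument of \<open>hyp\<close>
    tends to 0, where \<open>hyp\<close> is continuous with value 1.\<close>
  have "isCont hyp 0" using DERIV_hyp[of 0] by (intro DERIV_isCont) auto
  from isCont_tendsto_compose[OF this z]
  have "(\<lambda>n. hyp (1 - (b_seq a b n / a_seq a b n)^3) / a_seq a b n) \<longlonglongrightarrow> 1 / M3 a b"
    using M by (intro tendsto_divide lims) auto
  then show ?thesis unfolding inv by (simp add: LIMSEQ_const_iff)
qed

section \<open>Termwise evaluation of the integral \<open>K3\<close>\<close>

text \<open>Integration by parts: the moments satisfy
  \<open>(3*n + 3) * I (n + 1) = (3*n + 1) * I n\<close>, and the ratio is
  \<open>(1/3 + n) / (n + 1)\<close>.\<close>

lemma has_integral_cube_moment: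
  "((\<lambda>t::real. t^(3*n) / (1 - t^3) powr (1/3)) has_integral
     pochhammer (1/3) n / fact n * (pi3 / 2)) {0..1}"
proof (induction n)
  case 0
  show ?case using pi3_integrable by (simp add: pi3_def has_integral_iff)
next
  case (Suc n)
  define w where "w t = 1 / (1 - t^3) powr (1/3)" for t :: real
  \<comment> \<open>The primitive \<open>t^(3*n+1) * (1 - t^3) powr (2/3)\<close> vanishes at both
    ends. Its derivative is singular at 1, so differentiability is used only in the
    interior.\<close>
  have "((\<lambda>t. (3 * real n + 1) * (t^(3*n) * w t) - (3 * real n + 3) * (t^(3 * Suc n) * w t))
      has_integral (1^(3*n+1) * (1 - 1^3) powr (2/3) - 0^(3*n+1) * (1 - 0^3) powr (2/3))) {0..1::real}"
  proof (rule fundamental_theorem_of_calculus_interior)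
    show "continuous_on {0..1} (\<lambda>t::real. t^(3*n+1) * (1 - t^3) powr (2/3))"
      by (intro continuous_on_mult continuous_on_powr' continuous_intros) (auto simp: power_le_one)
    fix t :: real assume t: "t \<in> {0<..<1}"
    define s where "s = 1 - t^3"
    have s: "s > 0" using t by (simp add: s_def power_less_one_iff)
    have w: "s powr (2/3 - 1) = w t"
      using powr_minus_divide[of s "1/3"] by (simp add: w_def s_def)
    have w2: "s powr (2/3) = s * w t"
      using s powr_add[of s 1 "-1/3"] w by simp
    have d2: "((\<lambda>t. (1 - t^3) powr (2/3)) has_real_derivative
        2/3 * s powr (2/3 - 1) * (- 3 * t^2)) (at t)"
      unfolding s_def
      by (rule DERIV_chain2[OF has_real_derivative_powr])
        (use s in \<open>auto simp: s_def intro!: derivative_eq_intros simp: power2_eq_square\<close>)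
    have d1: "((\<lambda>t. t^(3*n+1)) has_real_derivative (3 * real n + 1) * t^(3*n)) (at t)"
      using DERIV_pow[of "3*n+1" t UNIV] by (simp add: add.commute)
    have "((\<lambda>t. t^(3*n+1) * (1 - t^3) powr (2/3)) has_real_derivative
       (3 * real n + 1) * t^(3*n) * (s * w t) + 2/3 * w t * (- 3 * t^2) * t^(3*n+1)) (at t)"
      using DERIV_mult[OF d1 d2] unfolding w w2[symmetric] by (simp add: s_def)
    also have "(3 * real n + 1) * t^(3*n) * (s * w t) + 2/3 * w t * (- 3 * t^2) * t^(3*n+1)
       = (3 * real n + 1) * (t^(3*n) * w t) - (3 * real n + 3) * (t^(3 * Suc n) * w t)"
      by (simp add: s_def power_add power2_eq_square power3_eq_cube algebra_simps)
    finally show "((\<lambda>t. t^(3*n+1) * (1 - t^3) powr (2/3)) has_vector_derivative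
       (3 * real n + 1) * (t^(3*n) * w t) - (3 * real n + 3) * (t^(3 * Suc n) * w t)) (at t)"
      by (simp add: has_real_derivative_iff_has_vector_derivative)
  qed simp
  then have "((\<lambda>t. (3 * real n + 1) * (t^(3*n) * w t) - (3 * real n + 3) * (t^(3 * Suc n) * w t))
      has_integral 0) {0..1}" by simp
  moreover have "((\<lambda>t. (3 * real n + 1) * (t^(3*n) * w t)) has_integral
      (3 * real n + 1) * (pochhammer (1/3) n / fact n * (pi3 / 2))) {0..1}"
    using has_integral_mult_right[OF Suc] by (simp add: w_def)
  \<comment> \<open>Subtraction gives existence of the next moment together with its value.\<close>
  ultimately have "((\<lambda>t. (3 * real n + 1) * (t^(3*n) * w t)
      - ((3 * real n + 1) * (t^(3*n) * w t) - (3 * real n + 3) * (t^(3 * Suc n) * w t)))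
      has_integral (3 * real n + 1) * (pochhammer (1/3) n / fact n * (pi3 / 2)) - 0) {0..1}"
    by (intro has_integral_diff)
  then have "((\<lambda>t. (3 * real n + 3) * (t^(3 * Suc n) * w t))
      has_integral (3 * real n + 1) * (pochhammer (1/3) n / fact n * (pi3 / 2))) {0..1}"
    by simp
  from has_integral_mult_right[OF this, of "1 / (3 * real n + 3)"]
  have "((\<lambda>t. t^(3 * Suc n) * w t)
      has_integral (3 * real n + 1) / (3 * real n + 3) * (pochhammer (1/3) n / fact n * (pi3 / 2))) {0..1}"
    by (simp add: add_nonneg_eq_0_iff)
  also have "(3 * real n + 1) / (3 * real n + 3) * (pochhammer (1/3) n / fact n * (pi3 / 2))
      = pochhammer (1/3) (Suc n) / fact (Suc n) * (pi3 / 2)"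
    by (simp add: pochhammer_Suc divide_simps) (simp add: algebra_simps)
  finally show ?case by (simp add: w_def)
qed

lemma binomial_two_thirds_sums:
  fixes y :: real
  assumes "\<bar>y\<bar> < 1"
  shows "(\<lambda>n. pochhammer (2/3) n / fact n * y^n) sums (1 / (1 - y) powr (2/3))"
proof -
  have "(\<lambda>n. ((-2/3) gchoose n) * (-y)^n) sums (1 + -y) powr (-2/3)"
    using assms by (intro gen_binomial_real) simp
  moreover have "((-2/3) gchoose n) * (-y)^n = pochhammer (2/3) n / fact n * y^n" for n
    by (subst power_minus) (simp add: gbinomial_pochhammer flip: mult.assoc power_mult_distrib)
  ultimately show ?thesis using powr_minus_divide[of "1 - y" "2/3"] by simp
qed

lemma K3_eq_hyp:
  assumes "0 \<le> k" "k < 1"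
  shows "K3 k = pi3 / 2 * hyp (k^3)"
proof -
  define w where "w t = 1 / (1 - t^3) powr (1/3)" for t :: real
  define h where "h t = 1 / ((1 - t^3) powr (1/3) * (1 - k^3 * t^3) powr (2/3))" for t :: real
  \<comment> \<open>Partial sums of the binomial expansion times the weight \<open>w\<close>. At
    \<open>t = 1\<close> both \<open>p N t\<close> and \<open>h t\<close> are 0, since
    \<open>w 1 = 1 / 0 = 0\<close>, so the endpoint needs no separate case.\<close>
  define p where "p N t = (\<Sum>n<N. pochhammer (2/3) n / fact n * (k^3)^n * (t^(3*n) * w t))" for N t
  have k3: "0 \<le> k^3" "k^3 < 1" using assms by (auto simp: power_less_one_iff)
  have p_alt: "p N t = (\<Sum>n<N. pochhammer (2/3) n / fact n * (k^3 * t^3)^n) * w t" for N t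
    unfolding p_def sum_distrib_right power_mult_distrib power_mult[of t] by (simp add: ac_simps)
  have h_alt: "h t = 1 / (1 - k^3 * t^3) powr (2/3) * w t" for t
    by (simp add: h_def w_def)
  have pI: "(p N has_integral
      (\<Sum>n<N. pochhammer (2/3) n / fact n * (k^3)^n * (pochhammer (1/3) n / fact n * (pi3 / 2)))) {0..1}" for N
    unfolding p_def using has_integral_cube_moment
    by (intro has_integral_sum has_integral_mult_right) (auto simp: w_def)
  have S: "(\<lambda>n. pochhammer (2/3) n / fact n * (k^3 * t^3)^n) sums (1 / (1 - k^3 * t^3) powr (2/3))"
    if "t \<in> {0..1}" for t
  proof (rule binomial_two_thirds_sums)
    have "k^3 * t^3 \<le> k^3 * 1" using that k3 by (intro mult_left_mono) (auto simp: power_le_one)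
    moreover have "0 \<le> k^3 * t^3" using that k3 by simp
    ultimately show "\<bar>k^3 * t^3\<bar> < 1" using k3 by linarith
  qed
  have "(\<lambda>N. integral {0..1} (p N)) \<longlonglongrightarrow> integral {0..1} h"
  \<comment> \<open>All terms of the expansion are nonnegative, so the limit \<open>h\<close>
    dominates its own partial sums.\<close>
  proof (rule dominated_convergence(2)[where h = h])
    show "p N integrable_on {0..1}" for N using pI by blast
    show "h integrable_on {0..1}" unfolding h_def by (rule K3_integrable[OF assms])
    fix t :: real assume t: "t \<in> {0..1}"
    have nn: "0 \<le> pochhammer (2/3) n / fact n * (k^3 * t^3)^n" for n
      using t k3 by (simp add: pochhammer_nonneg)
    have w0: "0 \<le> w t" by (simp add: w_def)
    show "norm (p N t) \<le> h t" for N
    proof -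
      have "(\<Sum>n<N. pochhammer (2/3) n / fact n * (k^3 * t^3)^n) \<le> 1 / (1 - k^3 * t^3) powr (2/3)"
        using sum_le_suminf[OF sums_summable[OF S[OF t]], of "{..<N}"] nn sums_unique[OF S[OF t]]
        by simp
      moreover have "0 \<le> (\<Sum>n<N. pochhammer (2/3) n / fact n * (k^3 * t^3)^n)"
        by (intro sum_nonneg nn)
      ultimately show ?thesis
        unfolding p_alt h_alt using w0 by (simp add: abs_mult mult_right_mono del: times_divide_eq_left)
    qed
    show "(\<lambda>N. p N t) \<longlonglongrightarrow> h t"
      unfolding p_alt h_alt using S[OF t] by (intro tendsto_mult tendsto_const) (simp add: sums_def)
  qed
  \<comment> \<open>The moment supplies \<open>pochhammer (1/3) n / fact n\<close> and the binomial
    series \<open>pochhammer (2/3) n / fact n\<close>; their product is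
    \<open>hyp_coeff n\<close>.\<close>
  moreover have "integral {0..1} (p N) = (\<Sum>n<N. pi3 / 2 * (hyp_coeff n * (k^3)^n))" for N
    using integral_unique[OF pI[of N]]
    by (simp add: hyp_coeff_def power2_eq_square mult_ac)
  moreover have "integral {0..1} h = K3 k" by (simp add: K3_def h_def[abs_def])
  ultimately have "(\<lambda>n. pi3 / 2 * (hyp_coeff n * (k^3)^n)) sums K3 k" by (simp add: sums_def)
  moreover have "(\<lambda>n. pi3 / 2 * (hyp_coeff n * (k^3)^n)) sums (pi3 / 2 * hyp (k^3))"
    unfolding hyp_def using k3
    by (intro sums_mult summable_sums summable_bounded_coeff abs_hyp_coeff_le_1) simp
  ultimately show ?thesis by (rule sums_unique2)
qed

theorem theorem1p2:
  fixes k k' :: real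
  assumes "0 \<le> k" "k < 1" and "k' = root 3 (1 - k^3)"
  shows "K3 k = pi3 / 2 * (1 / M3 1 k')"
proof -
  have k3: "0 \<le> k^3" "k^3 < 1" using assms by (auto simp: power_less_one_iff)
  then have k': "0 < k'" "k' \<le> 1" "k'^3 = 1 - k^3" using assms by auto
  \<comment> \<open>With \<open>a = 1\<close> and \<open>b = k'\<close>, the argument
    \<open>1 - (b/a)^3\<close> is exactly \<open>k^3\<close>.\<close>
  show ?thesis
    using hyp_eq_inverse_M3[OF k'(1,2)] K3_eq_hyp[OF assms(1,2)] k'(3) by simp
qed

end
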